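(* The second moment of the one-parameter family $E: y^2=4x^3+ax^2+bx+c+dt$ (with parameter $t$ and integer coefficients $a,b,c,d$) is $$A_{2,E}(p)=\begin{cases} p^2-p-p\left(\frac{-48}{p}\right)-p\left(\frac{a^2-12b}{p}\right) & \text{if } a^2-12b\neq 0,\\[4pt] p^2-p+p(p-1)\left(\frac{-48}{p}\right) & \text{otherwise.}\end{cases}$$
   Context: Here $p$ is an odd prime and $\left(\frac{\cdot}{p}\right)$ denotes the Legendre symbol, with $\left(\frac{u}{p}\right)=0$ if $p\mid u$. For a family $y^2=f_t(x)$, with $f_t(x)$ a cubic polynomial in $x$ whose coefficients are integer polynomials in $t$, one sets $a_t(p):=p-\#\{(x,y)\in(\mathbb{Z}/p\mathbb{Z})^2: y^2\equiv f_t(x) \bmod p\}=-\sum_{x \bmod p}\left(\frac{f_t(x)}{p}\right)$. The second moment is taken here without averaging over $t$: $A_{2,E}(p):=\sum_{t \bmod p}a_t(p)^2$, the sum running over all residues $t$ modulo $p$.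
   Formalization: Assumes p ≠ 3 and p ∤ d, and reads "a²−12b ≠ 0" modulo p; the claim as written fails otherwise (p=3, a=d=1: moment 6, formula 3; p=5, a=d=0, b=1: formula 30 is not 5 times a square). *)

theory Defs
  imports "HOL-Number_Theory.Number_Theory" "HOL-Computational_Algebra.Polynomial"
begin

text \<open>
  A family \<open>y\<^sup>2 = f\<^sub>t(x)\<close> is given by \<open>F :: int poly poly\<close>: the outer variable is \<open>x\<close>, and the
  coefficients are polynomials in the parameter \<open>t\<close>.
\<close>

definition fibre :: "int poly poly \<Rightarrow> int \<Rightarrow> int poly" where
  "fibre F t = map_poly (\<lambda>q. poly q t) F"

text \<open>Residue classes modulo \<open>p\<close> are represented by \<open>{0..<int p}\<close>.\<close>

definition affine_points :: "nat \<Rightarrow> int poly \<Rightarrow> (int \<times> int) set" where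
  "affine_points p f =
     {(x, y) \<in> {0..<int p} \<times> {0..<int p}. [y\<^sup>2 = poly f x] (mod int p)}"

definition frob_trace :: "int poly poly \<Rightarrow> nat \<Rightarrow> int \<Rightarrow> int" where
  "frob_trace F p t = int p - int (card (affine_points p (fibre F t)))"

text \<open>The second moment is not divided by \<open>p\<close>.\<close>

definition second_moment :: "int poly poly \<Rightarrow> nat \<Rightarrow> int" where
  "second_moment F p = (\<Sum>t\<in>{0..<int p}. (frob_trace F p t)\<^sup>2)"

definition cubic_family :: "int \<Rightarrow> int \<Rightarrow> int \<Rightarrow> int \<Rightarrow> int poly poly" where
  "cubic_family a b c d = [:[:c, d:], [:b:], [:a:], [:4:]:]"

lemma poly_fibre_cubic_family:
  "poly (fibre (cubic_family a b c d) t) x = 4 * x ^ 3 + a * x\<^sup>2 + b * x + c + d * t"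
  by (simp add: fibre_def cubic_family_def map_poly_pCons algebra_simps
      power2_eq_square power3_eq_cube)

end

theory Submission
  imports Defs
begin

text \<open>
  Expand the square of the trace and sum over \<open>t\<close> first: writing \<open>g(x) = 4x\<^sup>3 + ax\<^sup>2 + bx + c\<close>, the
  inner sum \<open>\<Sum>\<^sub>t ((g(x) + dt)/p) ((g(y) + dt)/p)\<close> is a complete character sum of a quadratic
  polynomial in \<open>t\<close>, equal to \<open>p - 1\<close> if \<open>g(x) = g(y)\<close> and to \<open>-1\<close> otherwise. Hence the second
  moment is \<open>pN - p\<^sup>2\<close>, where \<open>N\<close> counts the pairs with \<open>g(x) = g(y)\<close>. Such pairs lie on the
  line \<open>x = y\<close> or on the conic \<open>4(x\<^sup>2 + xy + y\<^sup>2) + a(x + y) + b = 0\<close>, which meet where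
  \<open>12x\<^sup>2 + 2ax + b = 0\<close>. For fixed \<open>y\<close> the conic is a quadratic equation in \<open>x\<close> with
  discriminant \<open>-48y\<^sup>2 - 8ay + a\<^sup>2 - 16b\<close>, so counting its points is again a quadratic character
  sum, whose value depends on whether \<open>p\<close> divides the discriminant \<open>256(a\<^sup>2 - 12b)\<close>.
\<close>

section \<open>Divisibility and the Legendre symbol modulo an odd prime\<close>

locale odd_prime =
  fixes p :: nat
  assumes prime_p: "prime p" and odd_p: "odd p"
begin

lemma p_gt_2: "p > 2"
  using prime_p odd_p prime_ge_2_nat[of p] by (cases "p = 2") auto

lemma prime_int_p: "prime (int p)"
  using prime_p by simp

lemma dvd_mult_iff: "int p dvd u * v \<longleftrightarrow> int p dvd u \<or> int p dvd v"
  using prime_int_p by (simp add: prime_dvd_mult_iff)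

lemma not_dvd_2: "\<not> int p dvd 2"
  using p_gt_2 by (auto dest!: zdvd_imp_le)

lemma dvd_4_mult_iff: "int p dvd 4 * u \<longleftrightarrow> int p dvd u"
  using dvd_mult_iff[of 2 "2 * u"] dvd_mult_iff[of 2 u] not_dvd_2 by simp

lemma Legendre_eq_0_iff: "Legendre u (int p) = 0 \<longleftrightarrow> int p dvd u"
  by (simp add: Legendre_def cong_0_iff)

lemma Legendre_cong:
  assumes "[u = v] (mod int p)"
  shows "Legendre u (int p) = Legendre v (int p)"
proof -
  have "[x = u] (mod int p) \<longleftrightarrow> [x = v] (mod int p)" for x
    using assms cong_sym cong_trans by blast
  moreover have "[u = 0] (mod int p) \<longleftrightarrow> [v = 0] (mod int p)"
    using assms cong_sym cong_trans by blast
  ultimately show ?thesis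
    by (simp add: Legendre_def QuadRes_def)
qed

text \<open>Euler's criterion gives the identity modulo \<open>p\<close>. Both sides lie in {-1, 0,
  1}, so they differ by at most 2, which is less than \<open>p\<close>.\<close>

lemma Legendre_mult:
  "Legendre (u * v) (int p) = Legendre u (int p) * Legendre v (int p)"
proof -
  let ?n = "(p - 1) div 2"
  have "[Legendre (u * v) (int p) = (u * v) ^ ?n] (mod int p)"
    using euler_criterion prime_p p_gt_2 by blast
  moreover have "[Legendre u (int p) * Legendre v (int p) = u ^ ?n * v ^ ?n] (mod int p)"
    using euler_criterion prime_p p_gt_2 cong_mult by blast
  ultimately have "[Legendre (u * v) (int p) = Legendre u (int p) * Legendre v (int p)] (mod int p)"
    by (metis cong_sym cong_trans power_mult_distrib)
  then have "int p dvd Legendre (u * v) (int p) - Legendre u (int p) * Legendre v (int p)"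
    by (simp add: cong_iff_dvd_diff)
  moreover have "\<bar>Legendre (u * v) (int p) - Legendre u (int p) * Legendre v (int p)\<bar> \<le> 2"
    by (simp add: Legendre_def)
  ultimately show ?thesis
    using p_gt_2 dvd_imp_le_int[of "Legendre (u * v) (int p) - Legendre u (int p) * Legendre v (int p)" "int p"]
    by linarith
qed

lemma Legendre_square_mult:
  assumes "\<not> int p dvd u"
  shows "Legendre (u\<^sup>2 * v) (int p) = Legendre v (int p)"
proof -
  have "Legendre u (int p) * Legendre u (int p) = 1"
    using assms by (simp add: Legendre_def cong_0_iff)
  then show ?thesis
    by (simp add: Legendre_mult power2_eq_square)
qed

section \<open>Counting roots of linear and quadratic polynomials\<close>

text \<open>The affine map permutes the residues, and \<open>h\<close> depends only on the residue
  class. This is the change of variable behind every shift and completed square below.\<close>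

lemma sum_affine:
  assumes h: "\<And>x y. [x = y] (mod int p) \<Longrightarrow> h x = h y" and \<alpha>: "\<not> int p dvd \<alpha>"
  shows "(\<Sum>x\<in>{0..<int p}. h (\<alpha> * x + \<beta>)) = (\<Sum>x\<in>{0..<int p}. h x)"
proof -
  let ?R = "{0..<int p}" and ?f = "\<lambda>x. (\<alpha> * x + \<beta>) mod int p"
  have p0: "int p > 0"
    using p_gt_2 by simp
  have "inj_on ?f ?R"
  proof (rule inj_onI)
    fix x y assume x: "x \<in> ?R" and y: "y \<in> ?R" and "?f x = ?f y"
    then have "int p dvd \<alpha> * (x - y)"
      by (simp add: mod_eq_dvd_iff algebra_simps)
    then have "int p dvd x - y"
      using \<alpha> dvd_mult_iff by blast
    then have "x mod int p = y mod int p"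
      by (simp add: mod_eq_dvd_iff)
    then show "x = y"
      using x y by simp
  qed
  moreover have "?f ` ?R \<subseteq> ?R"
    using p0 by auto
  ultimately have "bij_betw ?f ?R ?R"
    by (simp add: bij_betw_def endo_inj_surj)
  then have "(\<Sum>x\<in>?R. h (?f x)) = (\<Sum>x\<in>?R. h x)"
    by (rule sum.reindex_bij_betw)
  moreover have "h (?f x) = h (\<alpha> * x + \<beta>)" for x
    by (rule h) simp
  ultimately show ?thesis
    by simp
qed

lemma of_bool_dvd_cong:
  assumes "[x = y] (mod int p)"
  shows "of_bool (int p dvd x) = (of_bool (int p dvd y) :: int)"
  using assms by (simp add: cong_def dvd_eq_mod_eq_0)

lemma sum_of_bool_dvd_diff:
  assumes "y \<in> {0..<int p}"
  shows "(\<Sum>x\<in>{0..<int p}. of_bool (int p dvd x - y)) = (1::int)"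
proof -
  have "int p dvd x - y \<longleftrightarrow> x = y" if "x \<in> {0..<int p}" for x
    using that assms by (auto simp flip: mod_eq_dvd_iff)
  then have "(\<Sum>x\<in>{0..<int p}. of_bool (int p dvd x - y)) = (\<Sum>x\<in>{0..<int p}. of_bool (x = y) :: int)"
    by (intro sum.cong) auto
  also have "\<dots> = 1"
    using assms by (subst sum.remove[of _ y]) auto
  finally show ?thesis .
qed

lemma sum_of_bool_dvd_affine:
  assumes "\<not> int p dvd \<alpha>"
  shows "(\<Sum>x\<in>{0..<int p}. of_bool (int p dvd \<alpha> * x + \<beta>)) = (1::int)"
  using sum_affine[of "\<lambda>x. of_bool (int p dvd x) :: int", OF of_bool_dvd_cong assms, of \<beta>]
    sum_of_bool_dvd_diff[of 0] p_gt_2 by simp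

text \<open>This links point counts to character sums. If \<open>y\<close> is a square root of
  \<open>u\<close>, the roots are \<open>y\<close> and \<open>- y\<close>, which coincide modulo the
  odd prime \<open>p\<close> only when \<open>p\<close> divides \<open>y\<close>, that is, when the
  symbol is 0.\<close>

lemma sum_of_bool_dvd_square:
  "(\<Sum>x\<in>{0..<int p}. of_bool (int p dvd x\<^sup>2 - u)) = 1 + Legendre u (int p)"
proof (cases "QuadRes (int p) u")
  case False
  then have no_root: "\<not> int p dvd x\<^sup>2 - u" for x
    by (auto simp: QuadRes_def cong_iff_dvd_diff)
  then have "\<not> int p dvd u"
    using no_root[of 0] by simp
  then show ?thesis
    using False no_root by (simp add: Legendre_def cong_0_iff)
next
  case True
  then obtain y where "int p dvd y\<^sup>2 - u"
    by (auto simp: QuadRes_def cong_iff_dvd_diff)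
  then have "int p dvd x\<^sup>2 - u \<longleftrightarrow> int p dvd x\<^sup>2 - y\<^sup>2" for x
    using dvd_add_left_iff[of "int p" "y\<^sup>2 - u" "x\<^sup>2 - y\<^sup>2"] by simp
  then have root: "int p dvd x\<^sup>2 - u \<longleftrightarrow> int p dvd x - y \<or> int p dvd x + y" for x
    using dvd_mult_iff[of "x - y" "x + y"] by (simp add: algebra_simps power2_eq_square)
  \<comment> \<open>At \<open>x = 0\<close> the factorisation compares \<open>- u\<close> with
    \<open>- y\<close> and \<open>y\<close>.\<close>
  have u_dvd: "int p dvd u \<longleftrightarrow> int p dvd y"
    using root[of 0] by simp
  have one: "(\<Sum>x\<in>{0..<int p}. of_bool (int p dvd x + z)) = (1::int)" for z
    using sum_of_bool_dvd_affine[of 1 z] p_gt_2 by simp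
  show ?thesis
  proof (cases "int p dvd y")
    case True
    then have "int p dvd x\<^sup>2 - u \<longleftrightarrow> int p dvd x + 0" for x
      by (simp add: root dvd_add_left_iff dvd_diff_left_iff)
    moreover have "Legendre u (int p) = 0"
      using u_dvd True by (simp add: Legendre_eq_0_iff)
    ultimately show ?thesis
      using one[of 0] by simp
  next
    case False
    have "of_bool (int p dvd x\<^sup>2 - u) = (of_bool (int p dvd x + - y) + of_bool (int p dvd x + y) :: int)"
      for x
    proof -
      have "\<not> (int p dvd x - y \<and> int p dvd x + y)"
      proof
        assume "int p dvd x - y \<and> int p dvd x + y"
        then have "int p dvd (x + y) - (x - y)"
          by (blast intro: dvd_diff)
        then have "int p dvd 2 * y"
          by simp
        then show False
          using False not_dvd_2 dvd_mult_iff by blast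
      qed
      then show ?thesis
        by (auto simp: root)
    qed
    then have "(\<Sum>x\<in>{0..<int p}. of_bool (int p dvd x\<^sup>2 - u)) = (2::int)"
      using one[of "- y"] one[of y] by (simp add: sum.distrib)
    moreover have "Legendre u (int p) = 1"
      using u_dvd False \<open>QuadRes (int p) u\<close> by (simp add: Legendre_def cong_0_iff)
    ultimately show ?thesis
      by simp
  qed
qed

text \<open>The factor \<open>4 * \<alpha>\<close> avoids denominators; it is invertible modulo
  \<open>p\<close> when \<alpha> is.\<close>

lemma complete_square:
  fixes \<alpha> \<beta> \<gamma> x :: int
  shows "4 * (\<alpha> * (\<alpha> * x\<^sup>2 + \<beta> * x + \<gamma>)) = (2 * \<alpha> * x + \<beta>)\<^sup>2 - (\<beta>\<^sup>2 - 4 * \<alpha> * \<gamma>)"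
  by (simp add: algebra_simps power2_eq_square)

lemma sum_of_bool_dvd_quadratic:
  assumes "\<not> int p dvd \<alpha>"
  shows "(\<Sum>x\<in>{0..<int p}. of_bool (int p dvd \<alpha> * x\<^sup>2 + \<beta> * x + \<gamma>)) =
    1 + Legendre (\<beta>\<^sup>2 - 4 * \<alpha> * \<gamma>) (int p)"
proof -
  let ?D = "\<beta>\<^sup>2 - 4 * \<alpha> * \<gamma>"
  let ?h = "\<lambda>z. of_bool (int p dvd z\<^sup>2 - ?D) :: int"
  have "int p dvd \<alpha> * x\<^sup>2 + \<beta> * x + \<gamma> \<longleftrightarrow> int p dvd (2 * \<alpha> * x + \<beta>)\<^sup>2 - ?D" for x
    by (subst complete_square[symmetric]) (use assms in \<open>simp only: dvd_4_mult_iff dvd_mult_iff[of \<alpha>] simp_thms\<close>)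
  then have "(\<Sum>x\<in>{0..<int p}. of_bool (int p dvd \<alpha> * x\<^sup>2 + \<beta> * x + \<gamma>)) =
      (\<Sum>x\<in>{0..<int p}. ?h (2 * \<alpha> * x + \<beta>))"
    by simp
  also have "\<dots> = (\<Sum>z\<in>{0..<int p}. ?h z)"
  proof (rule sum_affine)
    show "?h x = ?h y" if "[x = y] (mod int p)" for x y
      by (intro of_bool_dvd_cong cong_diff cong_pow that cong_refl)
    show "\<not> int p dvd 2 * \<alpha>"
      using assms not_dvd_2 dvd_mult_iff by blast
  qed
  also have "\<dots> = 1 + Legendre ?D (int p)"
    by (rule sum_of_bool_dvd_square)
  finally show ?thesis .
qed

section \<open>Complete character sums of quadratic polynomials\<close>

text \<open>Substituting \<open>z = w + y\<close> makes the equation \<open>z\<^sup>2 - y\<^sup>2 = k\<close> linear in \<open>y\<close>.\<close>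

lemma sum_of_bool_dvd_hyperbola:
  "(\<Sum>z\<in>{0..<int p}. \<Sum>y\<in>{0..<int p}. of_bool (int p dvd y\<^sup>2 - (z\<^sup>2 - k))) =
    int p - 1 + int p * of_bool (int p dvd k)"
proof -
  let ?R = "{0..<int p}"
  have shift: "(\<Sum>z\<in>?R. of_bool (int p dvd y\<^sup>2 - (z\<^sup>2 - k))) =
      (\<Sum>w\<in>?R. of_bool (int p dvd (2 * w) * y + (w\<^sup>2 - k)) :: int)" for y
  proof -
    let ?h = "\<lambda>z. of_bool (int p dvd y\<^sup>2 - (z\<^sup>2 - k)) :: int"
    have "(\<Sum>w\<in>?R. ?h (1 * w + y)) = (\<Sum>z\<in>?R. ?h z)"
    proof (rule sum_affine)
      show "?h x = ?h y" if "[x = y] (mod int p)" for x y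
        by (intro of_bool_dvd_cong cong_diff cong_pow that cong_refl)
    qed (use p_gt_2 in simp)
    moreover have "y\<^sup>2 - ((1 * w + y)\<^sup>2 - k) = - ((2 * w) * y + (w\<^sup>2 - k))" for w
      by (simp add: algebra_simps power2_eq_square)
    ultimately show ?thesis
      by (simp only: dvd_minus_iff)
  qed
  have line: "(\<Sum>y\<in>?R. of_bool (int p dvd (2 * w) * y + (w\<^sup>2 - k))) = (1::int)" if "w \<in> ?R - {0}" for w
  proof (rule sum_of_bool_dvd_affine)
    have "\<not> int p dvd w"
      using that by (auto dest!: zdvd_imp_le)
    then show "\<not> int p dvd 2 * w"
      using not_dvd_2 dvd_mult_iff by blast
  qed
  have "(\<Sum>z\<in>?R. \<Sum>y\<in>?R. of_bool (int p dvd y\<^sup>2 - (z\<^sup>2 - k))) =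
      (\<Sum>w\<in>?R. \<Sum>y\<in>?R. of_bool (int p dvd (2 * w) * y + (w\<^sup>2 - k)) :: int)"
    by (subst sum.swap, subst shift, rule sum.swap)
  \<comment> \<open>For \<open>w = 0\<close> the condition is \<open>int p dvd - k\<close>,
    independent of \<open>y\<close>; each of the other \<open>p - 1\<close> values of
    \<open>w\<close> gives a linear equation with exactly one solution.\<close>
  also have "\<dots> = int p * of_bool (int p dvd k) + (\<Sum>w\<in>?R - {0}. 1)"
  proof -
    have "(\<Sum>y\<in>?R. of_bool (int p dvd (2 * 0) * y + (0\<^sup>2 - k))) = int p * of_bool (int p dvd k)"
      by simp
    moreover have "(0::int) \<in> ?R"
      using p_gt_2 by simp
    ultimately show ?thesis
      using sum.remove[of ?R 0 "\<lambda>w. \<Sum>y\<in>?R. of_bool (int p dvd (2 * w) * y + (w\<^sup>2 - k)) :: int"]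
      by (simp only: line finite_atLeastLessThan_int cong: sum.cong)
  qed
  also have "(\<Sum>w\<in>?R - {0}. 1) = int p - 1"
    using p_gt_2 by (simp add: card_Diff_singleton of_nat_diff)
  finally show ?thesis
    by simp
qed

text \<open>Summing over \<open>y\<close> first on the hyperbola gives 1 plus the symbol for each
  \<open>z\<close>; removing the \<open>p\<close> ones leaves the character sum.\<close>

lemma sum_Legendre_square_diff:
  "(\<Sum>z\<in>{0..<int p}. Legendre (z\<^sup>2 - k) (int p)) = int p * of_bool (int p dvd k) - 1"
  using sum_of_bool_dvd_hyperbola[of k] by (simp add: sum_of_bool_dvd_square sum.distrib)

text \<open>Multiplying the quadratic by the unit square \<open>(2 * \<alpha>)\<^sup>2\<close> keeps
  its symbol and turns it into \<alpha> times a difference \<open>z\<^sup>2 - D\<close>, with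
  \<open>z\<close> affine in \<open>x\<close> and \<open>D\<close> the discriminant.\<close>

lemma sum_Legendre_quadratic:
  assumes "\<not> int p dvd \<alpha>"
  shows "(\<Sum>x\<in>{0..<int p}. Legendre (\<alpha> * x\<^sup>2 + \<beta> * x + \<gamma>) (int p)) =
    Legendre \<alpha> (int p) * (int p * of_bool (int p dvd \<beta>\<^sup>2 - 4 * \<alpha> * \<gamma>) - 1)"
proof -
  let ?D = "\<beta>\<^sup>2 - 4 * \<alpha> * \<gamma>"
  let ?h = "\<lambda>z. Legendre (z\<^sup>2 - ?D) (int p)"
  have "Legendre (\<alpha> * x\<^sup>2 + \<beta> * x + \<gamma>) (int p) = Legendre \<alpha> (int p) * ?h (2 * \<alpha> * x + \<beta>)" for x
  proof -
    let ?q = "\<alpha> * x\<^sup>2 + \<beta> * x + \<gamma>"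
    have "Legendre \<alpha> (int p) * ?h (2 * \<alpha> * x + \<beta>) = Legendre (\<alpha> * (4 * (\<alpha> * ?q))) (int p)"
      by (simp only: complete_square Legendre_mult)
    also have "\<alpha> * (4 * (\<alpha> * ?q)) = (2 * \<alpha>)\<^sup>2 * ?q"
      by (simp add: power2_eq_square)
    also have "Legendre \<dots> (int p) = Legendre ?q (int p)"
      using assms not_dvd_2 dvd_mult_iff by (blast intro: Legendre_square_mult)
    finally show ?thesis ..
  qed
  then have "(\<Sum>x\<in>{0..<int p}. Legendre (\<alpha> * x\<^sup>2 + \<beta> * x + \<gamma>) (int p)) =
      Legendre \<alpha> (int p) * (\<Sum>x\<in>{0..<int p}. ?h (2 * \<alpha> * x + \<beta>))"
    by (simp add: sum_distrib_left)
  also have "(\<Sum>x\<in>{0..<int p}. ?h (2 * \<alpha> * x + \<beta>)) = (\<Sum>z\<in>{0..<int p}. ?h z)"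
  proof (rule sum_affine)
    show "?h x = ?h y" if "[x = y] (mod int p)" for x y
      by (intro Legendre_cong cong_diff cong_pow that cong_refl)
    show "\<not> int p dvd 2 * \<alpha>"
      using assms not_dvd_2 dvd_mult_iff by blast
  qed
  finally show ?thesis
    by (simp only: sum_Legendre_square_diff)
qed

text \<open>The product is the symbol of a quadratic in \<open>t\<close> whose leading coefficient
  \<open>d\<^sup>2\<close> has symbol 1 and whose discriminant is
  \<open>(d * (u - v))\<^sup>2\<close>.\<close>

lemma sum_Legendre_affine_mult:
  assumes "\<not> int p dvd d"
  shows "(\<Sum>t\<in>{0..<int p}. Legendre (u + d * t) (int p) * Legendre (v + d * t) (int p)) =
    int p * of_bool (int p dvd u - v) - 1"
proof -
  have "Legendre (u + d * t) (int p) * Legendre (v + d * t) (int p) =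
      Legendre (d\<^sup>2 * t\<^sup>2 + (d * (u + v)) * t + u * v) (int p)" for t
    by (simp add: algebra_simps power2_eq_square flip: Legendre_mult)
  moreover have "(d * (u + v))\<^sup>2 - 4 * d\<^sup>2 * (u * v) = d * (d * ((u - v) * (u - v)))"
    by (simp add: algebra_simps power2_eq_square)
  moreover have "Legendre (d\<^sup>2) (int p) = 1"
    using assms by (simp add: power2_eq_square Legendre_mult) (simp add: Legendre_def cong_0_iff)
  moreover have "\<not> int p dvd d\<^sup>2"
    using assms by (simp add: power2_eq_square dvd_mult_iff)
  ultimately show ?thesis
    using assms sum_Legendre_quadratic[of "d\<^sup>2" "d * (u + v)" "u * v"]
    by (simp add: dvd_mult_iff)
qed

section \<open>From point counts to pairs with equal values\<close>

lemma int_card_affine_points: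
  "int (card (affine_points p f)) = (\<Sum>x\<in>{0..<int p}. 1 + Legendre (poly f x) (int p))"
proof -
  let ?R = "{0..<int p}"
  have "affine_points p f = (SIGMA x:?R. {y \<in> ?R. int p dvd y\<^sup>2 - poly f x})"
    by (auto simp: affine_points_def cong_iff_dvd_diff)
  then have "int (card (affine_points p f)) = (\<Sum>x\<in>?R. int (card {y \<in> ?R. int p dvd y\<^sup>2 - poly f x}))"
    by (simp add: card_SigmaI del: atLeastLessThan_iff)
  moreover have "int (card {y \<in> ?R. int p dvd y\<^sup>2 - u}) = (\<Sum>y\<in>?R. of_bool (int p dvd y\<^sup>2 - u))" for u
    by (simp add: Int_def)
  ultimately show ?thesis
    by (simp only: sum_of_bool_dvd_square)
qed

lemma frob_trace_eq:
  "frob_trace F p t = - (\<Sum>x\<in>{0..<int p}. Legendre (poly (fibre F t) x) (int p))"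
  by (simp add: frob_trace_def int_card_affine_points sum.distrib)

text \<open>Only the shift by \<open>d * t\<close> matters, so \<open>g\<close> is arbitrary. The
  term \<open>(int p)\<^sup>2\<close> collects the -1 from each pair \<open>(x, y)\<close>.\<close>

lemma second_moment_translates:
  assumes d: "\<not> int p dvd d" and F: "\<And>t x. poly (fibre F t) x = g x + d * t"
  shows "second_moment F p =
    int p * (\<Sum>x\<in>{0..<int p}. \<Sum>y\<in>{0..<int p}. of_bool (int p dvd g x - g y)) - (int p)\<^sup>2"
proof -
  let ?R = "{0..<int p}" and ?L = "\<lambda>u. Legendre u (int p)"
  have "second_moment F p = (\<Sum>t\<in>?R. \<Sum>x\<in>?R. \<Sum>y\<in>?R. ?L (g x + d * t) * ?L (g y + d * t))"
    by (simp add: second_moment_def frob_trace_eq F power2_eq_square sum_product)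
  also have "\<dots> = (\<Sum>x\<in>?R. \<Sum>t\<in>?R. \<Sum>y\<in>?R. ?L (g x + d * t) * ?L (g y + d * t))"
    by (rule sum.swap)
  also have "\<dots> = (\<Sum>x\<in>?R. \<Sum>y\<in>?R. \<Sum>t\<in>?R. ?L (g x + d * t) * ?L (g y + d * t))"
    by (intro sum.cong refl sum.swap)
  also have "\<dots> = (\<Sum>x\<in>?R. \<Sum>y\<in>?R. int p * of_bool (int p dvd g x - g y) - 1)"
    by (simp only: sum_Legendre_affine_mult[OF d])
  also have "\<dots> = int p * (\<Sum>x\<in>?R. \<Sum>y\<in>?R. of_bool (int p dvd g x - g y)) - (int p)\<^sup>2"
    by (simp add: sum_subtractf power2_eq_square del: sum_of_bool_eq sum_mult_of_bool_eq flip: sum_distrib_left)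
  finally show ?thesis .
qed

section \<open>Collisions of the cubic for \<open>p\<close> different from 3\<close>

context
  assumes p_neq_3: "p \<noteq> 3"
begin

lemma not_dvd_3: "\<not> int p dvd 3"
proof
  assume "int p dvd 3"
  then have "int p \<le> 3"
    by (rule zdvd_imp_le) simp
  then show False
    using p_gt_2 p_neq_3 by simp
qed

lemma sum_of_bool_dvd_conic:
  "(\<Sum>y\<in>{0..<int p}. \<Sum>x\<in>{0..<int p}.
      of_bool (int p dvd 4 * x\<^sup>2 + (4 * y + a) * x + (4 * y\<^sup>2 + a * y + b))) =
    int p + Legendre (- 48) (int p) * (int p * of_bool (int p dvd a\<^sup>2 - 12 * b) - 1)"
proof -
  \<comment> \<open>The discriminant in \<open>x\<close> is again quadratic in \<open>y\<close>; its
    leading coefficient 16 - 64 is the source of -48.\<close>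
  have disc: "(4 * y + a)\<^sup>2 - 4 * 4 * (4 * y\<^sup>2 + a * y + b) = - 48 * y\<^sup>2 + (- 8 * a) * y + (a\<^sup>2 - 16 * b)" for y
    by (simp add: algebra_simps power2_eq_square)
  \<comment> \<open>The factor 256 is written as nested fours so that \<open>dvd_4_mult_iff\<close>
    can strip it.\<close>
  have disc': "(- 8 * a)\<^sup>2 - 4 * (- 48) * (a\<^sup>2 - 16 * b) = 4 * (4 * (4 * (4 * (a\<^sup>2 - 12 * b))))"
    by (simp add: algebra_simps power2_eq_square)
  have "\<not> int p dvd 4"
    using dvd_4_mult_iff[of 1] p_gt_2 by simp
  note count = sum_of_bool_dvd_quadratic[OF this]
  have "\<not> int p dvd - 48"
    using dvd_4_mult_iff[of 12] dvd_4_mult_iff[of 3] not_dvd_3 by simp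
  note character_sum = sum_Legendre_quadratic[OF this]
  show ?thesis
    by (simp only: count disc sum.distrib character_sum disc' dvd_4_mult_iff) simp
qed

text \<open>Inclusion-exclusion: \<open>p\<close> points on the line, plus those on the conic, minus
  their common points.\<close>

lemma sum_of_bool_dvd_cubic_collisions:
  fixes a b c :: int
  defines "g \<equiv> \<lambda>x. 4 * x ^ 3 + a * x\<^sup>2 + b * x + c"
  shows "(\<Sum>y\<in>{0..<int p}. \<Sum>x\<in>{0..<int p}. of_bool (int p dvd g x - g y)) =
    2 * int p + Legendre (- 48) (int p) * (int p * of_bool (int p dvd a\<^sup>2 - 12 * b) - 1)
      - 1 - Legendre (a\<^sup>2 - 12 * b) (int p)"
proof -
  let ?R = "{0..<int p}"
  let ?q = "\<lambda>x y. 4 * x\<^sup>2 + (4 * y + a) * x + (4 * y\<^sup>2 + a * y + b)"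
  have g: "int p dvd g x - g y \<longleftrightarrow> int p dvd x - y \<or> int p dvd ?q x y" for x y
  proof -
    \<comment> \<open>\<open>?q\<close> is the divided difference of \<open>g\<close>, in which
      \<open>c\<close> cancels.\<close>
    have "g x - g y = (x - y) * ?q x y"
      by (simp add: g_def algebra_simps power2_eq_square power3_eq_cube)
    then show ?thesis
      by (simp only: dvd_mult_iff)
  qed
  have split: "of_bool (int p dvd g x - g y) =
      (of_bool (int p dvd x - y) + of_bool (int p dvd ?q x y)
        - of_bool (x = y) * of_bool (int p dvd 12 * y\<^sup>2 + (2 * a) * y + b) :: int)"
    if "x \<in> ?R" "y \<in> ?R" for x y
  proof -
    have "int p dvd x - y \<longleftrightarrow> x = y"
      using that by (auto simp flip: mod_eq_dvd_iff)
    moreover have "?q y y = 12 * y\<^sup>2 + (2 * a) * y + b"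
      by (simp add: algebra_simps power2_eq_square)
    ultimately show ?thesis
      by (cases "x = y") (simp_all only: g, simp_all)
  qed
  have diagonal: "(\<Sum>x\<in>?R. of_bool (x = y) * s) = s" if "y \<in> ?R" for y s :: int
    using that by (subst sum.remove[of _ y]) auto
  \<comment> \<open>On the diagonal the conic becomes a quadratic with discriminant
    \<open>4 * (a\<^sup>2 - 12 * b)\<close>, whose square factor does not affect the symbol.\<close>
  have meet: "(\<Sum>y\<in>?R. of_bool (int p dvd 12 * y\<^sup>2 + (2 * a) * y + b)) =
      1 + Legendre (a\<^sup>2 - 12 * b) (int p)"
  proof -
    have "\<not> int p dvd 12"
      using dvd_4_mult_iff[of 3] not_dvd_3 by simp
    moreover have "(2 * a)\<^sup>2 - 4 * 12 * b = 2\<^sup>2 * (a\<^sup>2 - 12 * b)"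
      by (simp add: power2_eq_square)
    ultimately show ?thesis
      by (simp only: sum_of_bool_dvd_quadratic Legendre_square_mult[OF not_dvd_2] simp_thms)
  qed
  have "(\<Sum>y\<in>?R. \<Sum>x\<in>?R. of_bool (int p dvd g x - g y)) =
      (\<Sum>y\<in>?R. 1 + (\<Sum>x\<in>?R. of_bool (int p dvd ?q x y))
        - of_bool (int p dvd 12 * y\<^sup>2 + (2 * a) * y + b) :: int)"
  proof (intro sum.cong refl)
    fix y assume y: "y \<in> ?R"
    have "(\<Sum>x\<in>?R. of_bool (int p dvd g x - g y)) =
        (\<Sum>x\<in>?R. of_bool (int p dvd x - y) + of_bool (int p dvd ?q x y)
          - of_bool (x = y) * of_bool (int p dvd 12 * y\<^sup>2 + (2 * a) * y + b) :: int)"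
      using y by (intro sum.cong refl split)
    then show "(\<Sum>x\<in>?R. of_bool (int p dvd g x - g y)) =
        (1 + (\<Sum>x\<in>?R. of_bool (int p dvd ?q x y))
        - of_bool (int p dvd 12 * y\<^sup>2 + (2 * a) * y + b) :: int)"
      by (simp only: sum.distrib sum_subtractf diagonal[OF y] sum_of_bool_dvd_diff[OF y])
  qed
  also have "\<dots> = int p + (int p + Legendre (- 48) (int p) *
      (int p * of_bool (int p dvd a\<^sup>2 - 12 * b) - 1)) - (1 + Legendre (a\<^sup>2 - 12 * b) (int p))"
    by (simp only: sum.distrib sum_subtractf sum_of_bool_dvd_conic meet) simp
  finally show ?thesis
    by simp
qed

end

end

theorem lemma2p2:
  fixes p :: nat and a b c d :: int
  assumes "prime p" and "odd p" and "p \<noteq> 3" and "\<not> int p dvd d"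
  shows "second_moment (cubic_family a b c d) p =
    (if \<not> [a\<^sup>2 - 12 * b = 0] (mod int p)
     then (int p)\<^sup>2 - int p - int p * Legendre (- 48) (int p)
            - int p * Legendre (a\<^sup>2 - 12 * b) (int p)
     else (int p)\<^sup>2 - int p + int p * (int p - 1) * Legendre (- 48) (int p))"
proof -
  interpret odd_prime p
    using assms by unfold_locales
  let ?R = "{0..<int p}" and ?g = "\<lambda>x. 4 * x ^ 3 + a * x\<^sup>2 + b * x + c"
  have "second_moment (cubic_family a b c d) p =
      int p * (\<Sum>x\<in>?R. \<Sum>y\<in>?R. of_bool (int p dvd ?g x - ?g y)) - (int p)\<^sup>2"
    by (rule second_moment_translates[OF \<open>\<not> int p dvd d\<close> poly_fibre_cubic_family])
  also have "(\<Sum>x\<in>?R. \<Sum>y\<in>?R. of_bool (int p dvd ?g x - ?g y)) =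
      (\<Sum>y\<in>?R. \<Sum>x\<in>?R. of_bool (int p dvd ?g x - ?g y) :: int)"
    by (rule sum.swap)
  also have "\<dots> = 2 * int p + Legendre (- 48) (int p) * (int p * of_bool (int p dvd a\<^sup>2 - 12 * b) - 1)
      - 1 - Legendre (a\<^sup>2 - 12 * b) (int p)"
    by (rule sum_of_bool_dvd_cubic_collisions[OF \<open>p \<noteq> 3\<close>])
  \<comment> \<open>Both cases come from one formula: when \<open>p\<close> divides
    \<open>a\<^sup>2 - 12 * b\<close> the indicator is 1 and the last symbol vanishes; otherwise the
    indicator is 0.\<close>
  finally show ?thesis
    using Legendre_eq_0_iff[of "a\<^sup>2 - 12 * b"]
    by (auto simp: cong_0_iff algebra_simps power2_eq_square)
qed

end
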